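(* Assume the weak approximation property holds with constant $\eta_w>0$: for every $\mathbf v\in\mathbb R^n$ there is $\mathbf v_c\in\mathbb R^{n_c}$ with $\|\mathbf v-P\mathbf v_c\|_D\le\eta_w\|\mathbf v\|_A$. For $\mathbf f\in\mathbb R^n$ let $\mathbf u$ solve $A\mathbf u=\mathbf f$. Let $\nu\ge1$ and let $p_\nu(t)=1-t\,q_{\nu-1}(t)$ be the polynomial generated by $\nu$ steps of the conjugate gradient (CG) method with zero initial guess applied to $A_f\mathbf x=P_\perp^TA\pi_D\mathbf u$; that is, $q_{\nu-1}$ is a polynomial of degree at most $\nu-1$ such that $q_{\nu-1}(A_f)P_\perp^TA\pi_D\mathbf u$ is the $\nu$-th CG iterate. Let $\widetilde\pi_f=P_\perp q_{\nu-1}(A_f)P_\perp^TA$, $\widetilde P=(I-\widetilde\pi_f)P$, and let $\widetilde{\mathbf u}_c\in\mathbb R^{n_c}$ solve $\widetilde P^TA\widetilde P\,\widetilde{\mathbf u}_c=\widetilde P^T\mathbf f$. Then, with $q=\frac{\eta_w-1}{\eta_w+1}$, $$\|\mathbf u-\widetilde P\widetilde{\mathbf u}_c\|_A\le\eta_w\|D^{-\frac12}A\mathbf u\|+2q^\nu\eta_w\|\mathbf u\|_A.$$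
   Context: $A\in\mathbb R^{n\times n}$ is symmetric positive definite (SPD), and $D\in\mathbb R^{n\times n}$ is a diagonal SPD matrix with $\mathbf v^TA\mathbf v\le\mathbf v^TD\mathbf v$ for all $\mathbf v\in\mathbb R^n$. For an SPD matrix $B$, $\|\mathbf v\|_B=\sqrt{\mathbf v^TB\mathbf v}$; $\|\cdot\|$ is the Euclidean norm. The index set $\{1,\dots,n\}$ is partitioned into nonoverlapping aggregates $\mathcal A_1,\dots,\mathcal A_{n_a}$. The prolongation $P\in\mathbb R^{n\times n_c}$, of full column rank with $1\le n_c<n$, is block diagonal with respect to this partition, with blocks $P_{\mathcal A_i}$ (rows indexed by $\mathcal A_i$). On each aggregate, let $D_{\mathcal A_i}=D|_{\mathcal A_i}$ and choose vectors that are orthonormal with respect to $D_{\mathcal A_i}$ and span the $D_{\mathcal A_i}$-orthogonal complement of $\operatorname{Range}(P_{\mathcal A_i})$. Extended by zero outside $\mathcal A_i$, these vectors (for all $i$) are the columns of $P_\perp\in\mathbb R^{n\times(n-n_c)}$. Thus $P_\perp^TDP=0$ and $P_\perp^TDP_\perp=I$. Define $\pi_D=P(P^TDP)^{-1}P^TD$ and $A_f=P_\perp^TAP_\perp$. The $\nu$-th CG iterate with zero initial guess for $A_f\mathbf x=\mathbf b$ is the minimizer of $\|\mathbf y-A_f^{-1}\mathbf b\|_{A_f}$ over $\mathbf y$ in the Krylov space $\operatorname{span}\{\mathbf b,A_f\mathbf b,\dots,A_f^{\nu-1}\mathbf b\}$. *)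

theory Defs
  imports "HOL-Analysis.Analysis" "HOL-Computational_Algebra.Polynomial" "HOL-Library.Disjoint_Sets"
begin

definition spd :: "real^'n^'n \<Rightarrow> bool" where
  "spd B \<longleftrightarrow> transpose B = B \<and> (\<forall>v. v \<noteq> 0 \<longrightarrow> 0 < v \<bullet> (B *v v))"

definition diagonal :: "real^'n^'n \<Rightarrow> bool" where
  "diagonal B \<longleftrightarrow> (\<forall>i j. i \<noteq> j \<longrightarrow> B $ i $ j = 0)"

definition enorm :: "real^'n^'n \<Rightarrow> real^'n \<Rightarrow> real" where
  "enorm B v = sqrt (v \<bullet> (B *v v))"

(* The power -1/2 of a diagonal SPD matrix; the two lemmas below confirm that it is the
   SPD matrix whose square is the inverse of D. *)
definition diag_inv_sqrt :: "real^'n^'n \<Rightarrow> real^'n^'n" where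
  "diag_inv_sqrt D = (\<chi> i j. if i = j then 1 / sqrt (D $ i $ i) else 0)"

(* The power operation that the library has on this type would be entrywise. *)
primrec matpow :: "real^'n^'n \<Rightarrow> nat \<Rightarrow> real^'n^'n" where
  "matpow M 0 = mat 1"
| "matpow M (Suc k) = M ** matpow M k"

definition mat_poly :: "real poly \<Rightarrow> real^'n^'n \<Rightarrow> real^'n^'n" where
  "mat_poly p M = (\<Sum>i\<le>degree p. coeff p i *\<^sub>R matpow M i)"

definition krylov :: "real^'n^'n \<Rightarrow> real^'n \<Rightarrow> nat \<Rightarrow> (real^'n) set" where
  "krylov M b k = span ((\<lambda>i. matpow M i *v b) ` {..<k})"

definition cg_iterate :: "real^'n^'n \<Rightarrow> real^'n \<Rightarrow> nat \<Rightarrow> real^'n \<Rightarrow> bool" where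
  "cg_iterate M b k x \<longleftrightarrow> x \<in> krylov M b k \<and>
     (\<forall>y \<in> krylov M b k. enorm M (x - matrix_inv M *v b) \<le> enorm M (y - matrix_inv M *v b))"

(* A matrix is block diagonal with respect to a partition of its row indices when its columns
   are distributed over the aggregates (by the map c) and each column vanishes outside its
   aggregate. *)
definition block_diagonal :: "'n set set \<Rightarrow> ('m \<Rightarrow> 'n set) \<Rightarrow> real^'m^'n \<Rightarrow> bool" where
  "block_diagonal \<A> c P \<longleftrightarrow>
     (\<forall>j. c j \<in> \<A>) \<and> (\<forall>i j. i \<notin> c j \<longrightarrow> P $ i $ j = 0)"

(* Vectors indexed by an aggregate S are identified with their extensions by zero. *)
definition supported_on :: "'n set \<Rightarrow> (real^'n) set" where
  "supported_on S = {v. \<forall>i. i \<notin> S \<longrightarrow> v $ i = 0}"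

(* The bilinear form of the principal submatrix of D with rows and columns in S. *)
definition local_inner :: "real^'n^'n \<Rightarrow> 'n set \<Rightarrow> real^'n \<Rightarrow> real^'n \<Rightarrow> real" where
  "local_inner D S v w = (\<Sum>i\<in>S. \<Sum>j\<in>S. v $ i * D $ i $ j * w $ j)"

(* The span of the columns with block S. *)
definition block_range :: "('m \<Rightarrow> 'n set) \<Rightarrow> real^'m^'n \<Rightarrow> 'n set \<Rightarrow> (real^'n) set" where
  "block_range c P S = span {column j P | j. c j = S}"

definition local_complement ::
    "real^'n^'n \<Rightarrow> ('m \<Rightarrow> 'n set) \<Rightarrow> real^'m^'n \<Rightarrow> 'n set \<Rightarrow> (real^'n) set" where
  "local_complement D c P S =
     {v \<in> supported_on S. \<forall>w \<in> block_range c P S. local_inner D S v w = 0}"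

(* Q collects, over all aggregates, a local orthonormal basis of the local complement;
   the map d assigns to each column of Q the aggregate it comes from. *)
definition complement_basis ::
    "real^'n^'n \<Rightarrow> 'n set set \<Rightarrow> ('m \<Rightarrow> 'n set) \<Rightarrow> real^'m^'n
      \<Rightarrow> ('k \<Rightarrow> 'n set) \<Rightarrow> real^'k^'n \<Rightarrow> bool" where
  "complement_basis D \<A> c P d Q \<longleftrightarrow>
     block_diagonal \<A> d Q \<and>
     (\<forall>S\<in>\<A>.
        (\<forall>k l. d k = S \<longrightarrow> d l = S \<longrightarrow>
           local_inner D S (column k Q) (column l Q) = (if k = l then 1 else 0)) \<and>
        block_range d Q S = local_complement D c P S)"

definition pi_D :: "real^'n^'n \<Rightarrow> real^'c^'n \<Rightarrow> real^'n^'n" where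
  "pi_D D P = P ** matrix_inv (transpose P ** D ** P) ** transpose P ** D"

definition A_f :: "real^'n^'n \<Rightarrow> real^'f^'n \<Rightarrow> real^'f^'f" where
  "A_f A Q = transpose Q ** A ** Q"

definition pi_f_approx :: "real^'n^'n \<Rightarrow> real^'f^'n \<Rightarrow> real poly \<Rightarrow> real^'n^'n" where
  "pi_f_approx A Q p = Q ** mat_poly p (A_f A Q) ** transpose Q ** A"

definition P_approx :: "real^'n^'n \<Rightarrow> real^'f^'n \<Rightarrow> real poly \<Rightarrow> real^'c^'n \<Rightarrow> real^'c^'n" where
  "P_approx A Q p P = (mat 1 - pi_f_approx A Q p) ** P"

lemma spd_diag_pos:
  fixes D :: "real^'n^'n"
  assumes "spd D" "diagonal D"
  shows "0 < D $ i $ i"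
proof -
  have "0 < axis i 1 \<bullet> (D *v axis i 1)"
    using assms(1) by (simp add: spd_def axis_eq_0_iff)
  then show ?thesis
    by (simp add: inner_axis' matrix_vector_mult_basis column_def)
qed

lemma diag_inv_sqrt_square:
  fixes D :: "real^'n^'n"
  assumes "spd D" "diagonal D"
  shows "diag_inv_sqrt D ** diag_inv_sqrt D ** D = mat 1"
proof -
  have pos: "0 < D $ i $ i" for i
    using spd_diag_pos[OF assms] .
  have left: "(diag_inv_sqrt D ** M) $ i $ j = M $ i $ j / sqrt (D $ i $ i)" for M :: "real^'n^'n" and i j
  proof -
    have "(diag_inv_sqrt D ** M) $ i $ j
        = (\<Sum>k\<in>UNIV. if k = i then M $ i $ j / sqrt (D $ i $ i) else 0)"
      unfolding matrix_matrix_mult_def diag_inv_sqrt_def vec_lambda_beta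
      by (rule sum.cong) auto
    then show ?thesis by simp
  qed
  show ?thesis
  proof (simp only: vec_eq_iff, intro allI)
    fix i j
    have "(diag_inv_sqrt D ** diag_inv_sqrt D ** D) $ i $ j = D $ i $ j / (sqrt (D $ i $ i) * sqrt (D $ i $ i))"
      unfolding matrix_mul_assoc[symmetric] left by simp
    also have "\<dots> = D $ i $ j / D $ i $ i"
      using pos[of i] by simp
    also have "\<dots> = mat 1 $ i $ j"
      using pos[of i] assms(2) by (auto simp: mat_def diagonal_def)
    finally show "(diag_inv_sqrt D ** diag_inv_sqrt D ** D) $ i $ j = mat 1 $ i $ j" .
  qed
qed

lemma spd_diag_inv_sqrt:
  fixes D :: "real^'n^'n"
  assumes "spd D" "diagonal D"
  shows "spd (diag_inv_sqrt D)"
  unfolding spd_def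
proof (intro conjI allI impI)
  show "transpose (diag_inv_sqrt D) = diag_inv_sqrt D"
    by (auto simp: vec_eq_iff transpose_def diag_inv_sqrt_def)
next
  have pos: "0 < D $ i $ i" for i
    using spd_diag_pos[OF assms] .
  fix v :: "real^'n" assume "v \<noteq> 0"
  then obtain i where i: "v $ i \<noteq> 0" by (auto simp: vec_eq_iff)
  have comp: "(diag_inv_sqrt D *v v) $ k = v $ k / sqrt (D $ k $ k)" for k
  proof -
    have "(diag_inv_sqrt D *v v) $ k
        = (\<Sum>j\<in>UNIV. if j = k then v $ k / sqrt (D $ k $ k) else 0)"
      unfolding matrix_vector_mult_def diag_inv_sqrt_def vec_lambda_beta
      by (rule sum.cong) auto
    then show ?thesis by simp
  qed
  have "0 < (\<Sum>k\<in>UNIV. v $ k * v $ k / sqrt (D $ k $ k))"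
  proof (rule sum_pos2[where i = i])
    show "0 < v $ i * v $ i / sqrt (D $ i $ i)"
      using i pos[of i] by (intro divide_pos_pos) (auto simp: zero_less_mult_iff linorder_neq_iff)
    show "0 \<le> v $ k * v $ k / sqrt (D $ k $ k)" for k
      using pos[of k] by (intro divide_nonneg_pos) simp_all
  qed simp_all
  then show "0 < v \<bullet> (diag_inv_sqrt D *v v)"
    by (simp add: inner_vec_def comp)
qed

end

theory Submission
  imports Defs
begin

text \<open>
  The coarse solve is a Galerkin projection, so its error is at most that of the candidate
  \<open>P~ v\<^sub>c\<close> for any \<open>v\<^sub>c\<close>; here \<open>v\<^sub>c\<close> is taken with \<open>P v\<^sub>c = \<pi>\<^sub>D u\<close>. Let \<open>\<pi>\<^sub>f\<close> be the
  \<open>A\<close>-orthogonal projection onto the range of \<open>P\<^sub>\<perp>\<close>. As \<open>u - \<pi>\<^sub>D u\<close> lies in that range, it is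
  fixed by \<open>\<pi>\<^sub>f\<close>, and therefore
  \<open>u - P~ v\<^sub>c = (u - \<pi>\<^sub>D u) + \<pi>~\<^sub>f \<pi>\<^sub>D u = \<pi>\<^sub>f u - (\<pi>\<^sub>f - \<pi>~\<^sub>f) \<pi>\<^sub>D u\<close>.

  The weak approximation property makes \<open>\<parallel>x\<parallel>\<^sub>D \<le> \<eta> \<parallel>x + P y\<parallel>\<^sub>A\<close> for \<open>x\<close> in the range of \<open>P\<^sub>\<perp>\<close> and any
  \<open>y\<close>, because the best \<open>D\<close>-approximation of \<open>x + P y\<close> from the range of \<open>P\<close> leaves the error \<open>x\<close>.
  This is used three times.

  First, \<open>\<parallel>\<pi>\<^sub>f u\<parallel>\<^sub>A\<^sup>2 = (\<pi>\<^sub>f u)\<^sup>T A u \<le> \<parallel>\<pi>\<^sub>f u\<parallel>\<^sub>D \<parallel>D\<^sup>-\<^sup>1\<^sup>/\<^sup>2 A u\<parallel>\<close> gives the first term of the bound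
  (\<open>inner_le_enorm_dual\<close>).

  Secondly, the eigenvalues of \<open>A\<^sub>f\<close> lie between \<open>1 / \<eta>\<^sup>2\<close> and \<open>1\<close>. The vector
  \<open>(\<pi>\<^sub>f - \<pi>~\<^sub>f) \<pi>\<^sub>D u\<close> is the image under \<open>P\<^sub>\<perp>\<close> of the error of a CG iterate whose initial error is
  mapped to \<open>\<pi>\<^sub>f \<pi>\<^sub>D u\<close>. So the Chebyshev estimate for a condition number \<open>\<eta>\<^sup>2\<close> bounds it by
  \<open>2 q\<^sup>\<nu> \<parallel>\<pi>\<^sub>D u\<parallel>\<^sub>A\<close> (\<open>cg_error_bound\<close>).

  Thirdly, \<open>\<parallel>(I - \<pi>\<^sub>D) u\<parallel>\<^sub>A \<le> \<parallel>(I - \<pi>\<^sub>D) u\<parallel>\<^sub>D \<le> \<eta> \<parallel>u\<parallel>\<^sub>A\<close>, and a projection obeys the same bound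
  as its complementary projection, so that \<open>\<parallel>\<pi>\<^sub>D u\<parallel>\<^sub>A \<le> \<eta> \<parallel>u\<parallel>\<^sub>A\<close> (\<open>oblique_complement_bound\<close>).

  The Chebyshev estimate is proved without diagonalising \<open>A\<^sub>f\<close>. The Pell identity
  \<open>T\<^sub>k\<^sup>2 + (1 - x\<^sup>2) U\<^sub>k\<^sub>-\<^sub>1\<^sup>2 = 1\<close> holds for operators as well, and it bounds the energy of
  \<open>T\<^sub>k(S) e\<close> by that of \<open>e\<close> as soon as the quadratic form of \<open>M (1 - S\<^sup>2)\<close> is nonnegative, where
  \<open>S\<close> is the affine image of \<open>M\<close> that maps the spectral interval to \<open>[-1, 1]\<close>. That
  form is nonnegative because, for \<open>\<eta> > 1\<close>, an algebraic identity writes a positive multiple of \<open>M (1 - S\<^sup>2)\<close> as a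
  sum of congruences of the nonnegative operators \<open>M - 1 / \<eta>\<^sup>2\<close> and \<open>1 - M\<close>.
\<close>

section \<open>Chebyshev bound on Krylov spaces\<close>

text \<open>
  The quadratic form stands in for the spectrum of \<open>M\<close>: its bounds confine the spectrum to
  \<open>[1 / \<eta>\<^sup>2, 1]\<close>.
\<close>

locale spectral_interval =
  fixes M :: "'a::real_inner \<Rightarrow> 'a" and \<eta> :: real
  assumes linear: "linear M"
    and selfadjoint: "M x \<bullet> y = x \<bullet> M y"
    and upper: "x \<bullet> M x \<le> x \<bullet> x"
    and lower: "x \<bullet> x \<le> \<eta>\<^sup>2 * (x \<bullet> M x)"
    and one_le: "1 \<le> \<eta>"
begin

text \<open>
  The affine map from \<open>[1 / \<eta>\<^sup>2, 1]\<close> to \<open>[-1, 1]\<close> divides by \<open>\<eta>\<^sup>2 - 1\<close>. To admit \<open>\<eta> = 1\<close>, all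
  Chebyshev quantities are scaled by powers of \<open>\<rho>\<close>: with \<open>S\<close> the image of \<open>M\<close> under the decreasing
  such map, \<open>R = \<rho> S\<close>, \<open>W = \<rho>\<^sup>2 (1 - S\<^sup>2)\<close>, \<open>U k e = \<rho>\<^sup>k\<^sup>-\<^sup>1 U\<^sub>k\<^sub>-\<^sub>1(S) e\<close> and \<open>T k e = \<rho>\<^sup>k T\<^sub>k(S) e\<close>,
  where \<open>U\<^sub>j\<close> and \<open>T\<^sub>j\<close> on the right are the Chebyshev polynomials.
\<close>

definition \<rho> :: real where "\<rho> = (\<eta> - 1) / (\<eta> + 1)"

definition R :: "'a \<Rightarrow> 'a" where
  "R x = (1 / (\<eta> + 1)\<^sup>2) *\<^sub>R ((\<eta>\<^sup>2 + 1) *\<^sub>R x - (2 * \<eta>\<^sup>2) *\<^sub>R M x)"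

definition W :: "'a \<Rightarrow> 'a" where "W x = \<rho>\<^sup>2 *\<^sub>R x - R (R x)"

fun U :: "nat \<Rightarrow> 'a \<Rightarrow> 'a" where
  "U 0 e = 0"
| "U (Suc 0) e = e"
| "U (Suc (Suc k)) e = 2 *\<^sub>R R (U (Suc k) e) - \<rho>\<^sup>2 *\<^sub>R U k e"

definition T :: "nat \<Rightarrow> 'a \<Rightarrow> 'a" where "T k e = U (Suc k) e - R (U k e)"

text \<open>
  The value of the scaled polynomial \<open>\<rho>\<^sup>k T\<^sub>k\<close> at \<open>(\<rho> + 1 / \<rho>) / 2\<close>, the image of \<open>0\<close> under the affine
  map. Dividing by it normalises the residual polynomial to \<open>1\<close> at \<open>0\<close>.
\<close>

definition \<tau> :: "nat \<Rightarrow> real" where "\<tau> k = (1 + (\<rho>\<^sup>2) ^ k) / 2"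

lemmas M_simps = linear_add[OF linear] linear_diff[OF linear] linear_scale[OF linear] linear_0[OF linear]

lemma linear_R: "linear R"
  by (rule linearI) (simp_all add: R_def M_simps algebra_simps)

lemmas R_simps = linear_add[OF linear_R] linear_diff[OF linear_R] linear_scale[OF linear_R] linear_0[OF linear_R]

lemma linear_W: "linear W"
  by (rule linearI) (simp_all add: W_def R_simps algebra_simps)

lemmas W_simps = linear_add[OF linear_W] linear_diff[OF linear_W] linear_scale[OF linear_W] linear_0[OF linear_W]

lemma R_selfadjoint: "R x \<bullet> y = x \<bullet> R y"
  by (simp add: R_def inner_diff_left inner_diff_right selfadjoint)

lemma W_selfadjoint: "W x \<bullet> y = x \<bullet> W y"
  by (simp add: W_def inner_diff_left inner_diff_right R_selfadjoint)

lemma R_M: "R (M x) = M (R x)"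
  by (simp add: R_def M_simps)

lemma W_M: "W (M x) = M (W x)"
  by (simp add: W_def R_M M_simps)

lemma W_R: "W (R x) = R (W x)"
  by (simp add: W_def R_simps)

lemma T_0: "T 0 e = e"
  by (simp add: T_def R_simps)

lemma U_Suc: "U (Suc k) e = R (U k e) + T k e"
  by (simp add: T_def)

lemma T_Suc: "T (Suc k) e = R (T k e) - W (U k e)"
proof -
  have "T (Suc k) e = R (U (Suc k) e) - \<rho>\<^sup>2 *\<^sub>R U k e"
    by (simp add: T_def scaleR_2)
  then show ?thesis
    by (simp add: U_Suc W_def R_simps)
qed

lemma T_three_term: "T (Suc (Suc k)) e = 2 *\<^sub>R R (T (Suc k) e) - \<rho>\<^sup>2 *\<^sub>R T k e"
  by (simp add: T_def R_simps algebra_simps)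

lemma R_square_plus_W: "R (R x) + W x = \<rho>\<^sup>2 *\<^sub>R x"
  by (simp add: W_def)

text \<open>
  In one step the two squares recombine as in
  \<open>(R t - W v)\<^sup>2 + W (R v + t)\<^sup>2 = (R\<^sup>2 + W) (t\<^sup>2 + W v\<^sup>2)\<close>: the mixed terms cancel because \<open>R\<close>, \<open>W\<close>
  and \<open>M\<close> commute and are self-adjoint.
\<close>

lemma pell_identity:
  "T k e \<bullet> M (T k e) + W (U k e) \<bullet> M (U k e) = (\<rho>\<^sup>2) ^ k * (e \<bullet> M e)"
proof (induction k)
  case 0
  show ?case by (simp add: T_0 W_simps)
next
  case (Suc k)
  define t where "t = T k e"
  define v where "v = U k e"
  have cross: "R t \<bullet> M (W v) = W v \<bullet> M (R t)" "t \<bullet> M (W (R v)) = W (R v) \<bullet> M t"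
    by (metis inner_commute selfadjoint)+
  have *: "W v \<bullet> M (R t) = W (R v) \<bullet> M t" "W t \<bullet> M (R v) = W (R v) \<bullet> M t"
    using cross by (simp_all add: R_M W_M W_R R_selfadjoint W_selfadjoint)
  have "T (Suc k) e \<bullet> M (T (Suc k) e) + W (U (Suc k) e) \<bullet> M (U (Suc k) e)
      = (R t - W v) \<bullet> M (R t - W v) + W (R v + t) \<bullet> M (R v + t)"
    by (simp add: T_Suc U_Suc t_def v_def)
  also have "\<dots> = (R t \<bullet> M (R t) + W t \<bullet> M t) + (W v \<bullet> M (W v) + W (R v) \<bullet> M (R v))"
    using cross * by (simp add: M_simps W_simps inner_diff_left inner_diff_right inner_add_left inner_add_right)
  also have "R t \<bullet> M (R t) + W t \<bullet> M t = (R (R t) + W t) \<bullet> M t"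
    by (simp add: inner_add_left R_selfadjoint R_M)
  also have "W v \<bullet> M (W v) + W (R v) \<bullet> M (R v) = W (R (R v) + W v) \<bullet> M v"
    by (simp add: inner_add_left W_simps W_selfadjoint R_selfadjoint W_M R_M W_R)
  also have "(R (R t) + W t) \<bullet> M t + W (R (R v) + W v) \<bullet> M v
      = \<rho>\<^sup>2 * (t \<bullet> M t + W v \<bullet> M v)"
    by (simp only: R_square_plus_W) (simp add: W_simps distrib_left)
  finally show ?case
    using Suc.IH by (simp add: t_def v_def)
qed

text \<open>
  With \<open>X = \<eta>\<^sup>2 M - 1\<close> and \<open>Y = 1 - M\<close> the sum \<open>X + \<eta>\<^sup>2 Y\<close> is the scalar \<open>\<eta>\<^sup>2 - 1\<close>, so that
  \<open>(\<eta>\<^sup>2 - 1) X Y = X Y X + \<eta>\<^sup>2 Y X Y\<close>, and each summand is a congruence of a nonnegative form. For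
  \<open>\<eta> = 1\<close> the scalar vanishes, but then the form of \<open>Y\<close> is zero and, by polarisation, so is \<open>Y\<close>.
\<close>

lemma lower_upper_nonneg: "0 \<le> (\<eta>\<^sup>2 *\<^sub>R M x - x) \<bullet> (x - M x)"
proof (cases "\<eta> = 1")
  case True
  have eq: "z \<bullet> M z = z \<bullet> z" for z
    using upper[of z] lower[of z] True by simp
  have "M x \<bullet> (x - M x) = x \<bullet> (x - M x)"
    using eq[of "x + (x - M x)"] eq[of x] eq[of "x - M x"]
    by (simp add: M_simps inner_simps selfadjoint inner_commute)
  then show ?thesis
    using True by (simp add: inner_diff_left)
next
  case False
  define X where "X z = \<eta>\<^sup>2 *\<^sub>R M z - z" for z
  define Y where "Y z = z - M z" for z
  have X: "0 \<le> z \<bullet> X z" for z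
    using lower[of z] by (simp add: X_def inner_diff_right)
  have Y: "0 \<le> z \<bullet> Y z" for z
    using upper[of z] by (simp add: Y_def inner_diff_right)
  have "(\<eta>\<^sup>2 - 1) * (X x \<bullet> Y x) = X x \<bullet> Y (X x) + \<eta>\<^sup>2 * (Y x \<bullet> X (Y x))"
    by (simp add: X_def Y_def M_simps inner_simps selfadjoint algebra_simps)
  also have "\<dots> \<ge> 0"
    using X[of "Y x"] Y[of "X x"] by simp
  finally have "0 \<le> (\<eta>\<^sup>2 - 1) * (X x \<bullet> Y x)" .
  moreover have "0 < \<eta>\<^sup>2 - 1"
    using one_le False by (simp add: one_less_power)
  ultimately show ?thesis
    by (simp add: zero_le_mult_iff X_def Y_def)
qed

lemma W_factor:
  "W x = (4 * \<eta>\<^sup>2 / (\<eta> + 1) ^ 4) *\<^sub>R (\<eta>\<^sup>2 *\<^sub>R M (x - M x) - (x - M x))"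
proof -
  define a where "a = (\<eta>\<^sup>2 + 1) / (\<eta> + 1)\<^sup>2"
  define b where "b = 2 * \<eta>\<^sup>2 / (\<eta> + 1)\<^sup>2"
  define g where "g = 4 * \<eta>\<^sup>2 / (\<eta> + 1) ^ 4"
  have nz: "\<eta> + 1 \<noteq> 0" using one_le by simp
  have R: "R z = a *\<^sub>R z - b *\<^sub>R M z" for z
    by (simp add: R_def a_def b_def scaleR_diff_right)
  have coeffs: "\<rho>\<^sup>2 - a * a = - g" "a * b + a * b = g * (\<eta>\<^sup>2 + 1)" "b * b = g * \<eta>\<^sup>2"
    using nz by (simp_all add: \<rho>_def a_def b_def g_def field_simps) algebra+
  have "W x = (\<rho>\<^sup>2 - a * a) *\<^sub>R x + (a * b + a * b) *\<^sub>R M x - (b * b) *\<^sub>R M (M x)"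
    by (simp add: W_def R M_simps algebra_simps) (simp flip: scaleR_add_left)
  also have "\<dots> = g *\<^sub>R (\<eta>\<^sup>2 *\<^sub>R M (x - M x) - (x - M x))"
    unfolding coeffs by (simp add: M_simps algebra_simps)
  finally show ?thesis by (simp add: g_def)
qed

text \<open>
  Up to a positive factor \<open>W M\<close> is \<open>X Y M\<close> with the same \<open>X\<close> and \<open>Y\<close>, and substituting
  \<open>\<eta>\<^sup>2 M = X + 1\<close> splits \<open>\<eta>\<^sup>2 X Y M\<close> into \<open>X Y X + X Y\<close>.
\<close>

lemma W_M_nonneg: "0 \<le> W x \<bullet> M x"
proof -
  define X where "X = \<eta>\<^sup>2 *\<^sub>R M x - x"
  have "\<eta>\<^sup>2 * ((\<eta>\<^sup>2 *\<^sub>R M (x - M x) - (x - M x)) \<bullet> M x)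
      = X \<bullet> (X - M X) + (\<eta>\<^sup>2 *\<^sub>R M x - x) \<bullet> (x - M x)"
    by (simp add: X_def M_simps inner_simps selfadjoint algebra_simps)
  also have "\<dots> \<ge> 0"
    using upper[of X] lower_upper_nonneg[of x] by (simp add: inner_diff_right)
  finally have "0 \<le> (\<eta>\<^sup>2 *\<^sub>R M (x - M x) - (x - M x)) \<bullet> M x"
    using one_le by (simp add: zero_le_mult_iff)
  then show ?thesis
    using one_le by (simp add: W_factor)
qed

lemma T_energy: "T k e \<bullet> M (T k e) \<le> (\<rho>\<^sup>2) ^ k * (e \<bullet> M e)"
  using pell_identity[of k e] W_M_nonneg[of "U k e"] by simp

lemma \<tau>_1: "\<tau> 1 = (\<eta>\<^sup>2 + 1) / (\<eta> + 1)\<^sup>2"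
proof -
  have "\<eta> + 1 \<noteq> 0" using one_le by simp
  then show ?thesis
    by (simp add: \<tau>_def \<rho>_def field_simps) algebra
qed

lemma \<tau>_three_term: "\<tau> (Suc (Suc k)) = 2 * \<tau> 1 * \<tau> (Suc k) - \<rho>\<^sup>2 * \<tau> k"
  by (simp add: \<tau>_def field_simps)

lemma R_alt: "R x = \<tau> 1 *\<^sub>R x - (2 * \<eta>\<^sup>2 / (\<eta> + 1)\<^sup>2) *\<^sub>R M x"
  by (simp only: \<tau>_1) (simp add: R_def scaleR_diff_right)

definition K :: "'a \<Rightarrow> nat \<Rightarrow> 'a set" where
  "K b k = span ((\<lambda>i. (M ^^ i) b) ` {..<k})"

lemma K_mono: "j \<le> k \<Longrightarrow> K b j \<subseteq> K b k"
  unfolding K_def by (intro span_mono image_mono) auto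

lemma M_K: "x \<in> K b k \<Longrightarrow> M x \<in> K b (Suc k)"
proof -
  assume "x \<in> K b k"
  then have "M x \<in> M ` span ((\<lambda>i. (M ^^ i) b) ` {..<k})"
    by (simp add: K_def)
  also have "\<dots> = span ((\<lambda>i. (M ^^ Suc i) b) ` {..<k})"
    by (simp add: linear_span_image[OF linear, symmetric] image_image)
  also have "\<dots> \<subseteq> K b (Suc k)"
    unfolding K_def
  proof (intro span_mono image_subsetI)
    fix i assume "i \<in> {..<k}"
    then have "Suc i \<in> {..<Suc k}" by simp
    then show "(M ^^ Suc i) b \<in> (\<lambda>i. (M ^^ i) b) ` {..<Suc k}" by (rule imageI)
  qed
  finally show ?thesis .
qed

lemma R_K:
  assumes "x \<in> K b k" shows "R x \<in> K b (Suc k)"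
proof -
  have "x \<in> K b (Suc k)" "M x \<in> K b (Suc k)"
    using assms K_mono[of k "Suc k" b] M_K by auto
  then show ?thesis
    unfolding R_alt K_def by (intro span_diff span_scale)
qed

text \<open>
  The difference is \<open>p(M) e\<close> for a polynomial \<open>p\<close> of degree at most \<open>k\<close> that vanishes at \<open>0\<close>. The
  induction runs on the three-term recurrences of \<open>T\<close> and \<open>\<tau>\<close>; they match up to a multiple of
  \<open>R e - \<tau>\<^sub>1 e\<close>, which is a multiple of \<open>M e\<close>.
\<close>

lemma T_K: "T k e - \<tau> k *\<^sub>R e \<in> K (M e) k"
proof (induction k rule: induct_nat_012)
  case 0
  show ?case by (simp add: T_0 \<tau>_def K_def)
next
  case 1
  have "M e \<in> K (M e) 1" unfolding K_def by (intro span_base) force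
  moreover have "T (Suc 0) e - \<tau> (Suc 0) *\<^sub>R e = - (2 * \<eta>\<^sup>2 / (\<eta> + 1)\<^sup>2) *\<^sub>R M e"
    by (simp add: T_def R_simps scaleR_2) (simp add: R_alt)
  ultimately show ?case
    by (simp add: K_def span_neg span_scale)
next
  case (ge2 k)
  let ?k = "Suc (Suc k)"
  have Me: "M e \<in> K (M e) ?k"
  proof -
    have "M e \<in> K (M e) 1" unfolding K_def by (intro span_base) force
    then show ?thesis using K_mono[of 1 ?k "M e"] by auto
  qed
  have "T ?k e - \<tau> ?k *\<^sub>R e
      = 2 *\<^sub>R R (T (Suc k) e - \<tau> (Suc k) *\<^sub>R e) - \<rho>\<^sup>2 *\<^sub>R (T k e - \<tau> k *\<^sub>R e)
        + (2 * \<tau> (Suc k)) *\<^sub>R (R e - \<tau> 1 *\<^sub>R e)"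
    by (simp add: T_three_term \<tau>_three_term R_simps algebra_simps)
  moreover have "R (T (Suc k) e - \<tau> (Suc k) *\<^sub>R e) \<in> K (M e) ?k"
    using ge2.IH(2) by (rule R_K)
  moreover have "T k e - \<tau> k *\<^sub>R e \<in> K (M e) ?k"
    using ge2.IH(1) K_mono[of k ?k "M e"] by auto
  moreover have "R e - \<tau> 1 *\<^sub>R e \<in> K (M e) ?k"
    using Me by (simp add: R_alt K_def span_neg span_scale)
  ultimately show ?case
    by (metis K_def span_add span_diff span_scale)
qed

text \<open>
  The residual is \<open>T\<^sub>k e / \<tau>\<^sub>k\<close>: the energy of \<open>T\<^sub>k e\<close> is at most \<open>\<rho>\<^sup>2\<^sup>k\<close> times that of \<open>e\<close>, and
  \<open>\<tau>\<^sub>k \<ge> 1 / 2\<close>, whence the factor \<open>2\<close>.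
\<close>

lemma krylov_energy_bound:
  "\<exists>y \<in> K (M e) k. (e - y) \<bullet> M (e - y) \<le> (2 * \<rho> ^ k)\<^sup>2 * (e \<bullet> M e)"
proof
  define y where "y = (- inverse (\<tau> k)) *\<^sub>R (T k e - \<tau> k *\<^sub>R e)"
  have \<tau>: "1 / 2 \<le> \<tau> k" by (simp add: \<tau>_def)
  show "y \<in> K (M e) k"
    using T_K unfolding y_def K_def by (rule span_scale)
  have y: "e - y = inverse (\<tau> k) *\<^sub>R T k e"
    using \<tau> by (simp add: y_def algebra_simps)
  have inv: "(inverse (\<tau> k))\<^sup>2 \<le> 2\<^sup>2"
    using \<tau> by (intro power_mono) (auto simp: field_simps)
  have nn: "0 \<le> (\<rho>\<^sup>2) ^ k * (e \<bullet> M e)"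
  proof -
    have "0 \<le> \<eta>\<^sup>2 * (e \<bullet> M e)" using inner_ge_zero[of e] lower[of e] by linarith
    then show ?thesis using one_le by (auto simp: zero_le_mult_iff)
  qed
  have "(e - y) \<bullet> M (e - y) = (inverse (\<tau> k))\<^sup>2 * (T k e \<bullet> M (T k e))"
    by (simp add: y M_simps power2_eq_square)
  also have "\<dots> \<le> (inverse (\<tau> k))\<^sup>2 * ((\<rho>\<^sup>2) ^ k * (e \<bullet> M e))"
    by (intro mult_left_mono T_energy) simp
  also have "\<dots> \<le> 2\<^sup>2 * ((\<rho>\<^sup>2) ^ k * (e \<bullet> M e))"
    using inv nn by (rule mult_right_mono)
  also have "\<dots> = (2 * \<rho> ^ k)\<^sup>2 * (e \<bullet> M e)"
    by (simp add: power_mult_distrib power_mult[symmetric] mult.commute)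
  finally show "(e - y) \<bullet> M (e - y) \<le> (2 * \<rho> ^ k)\<^sup>2 * (e \<bullet> M e)" .
qed

end



section \<open>Energy norms\<close>

lemma inner_transpose_mult:
  fixes B :: "real^'m^'n"
  shows "x \<bullet> (transpose B *v y) = (B *v x) \<bullet> y"
  by (simp add: inner_commute[of x] inner_commute[of _ y] dot_lmul_matrix)

lemma mult_matrix_inv:
  fixes B :: "real^'n^'n"
  assumes "\<And>x. B *v x = 0 \<Longrightarrow> x = 0"
  shows "B *v (matrix_inv B *v b) = b"
proof -
  have "invertible B"
    using assms by (auto simp: invertible_left_inverse matrix_left_invertible_ker)
  then have "B ** matrix_inv B = mat 1"
    unfolding invertible_def matrix_inv_def by (rule someI2_ex) simp
  then show ?thesis
    by (simp add: matrix_vector_mul_assoc)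
qed

lemma spd_inner_commute:
  assumes "spd B" shows "x \<bullet> (B *v y) = y \<bullet> (B *v x)"
  using inner_transpose_mult[of x B y] assms by (simp add: spd_def inner_commute del: transpose_matrix_vector)

lemma spd_nonneg: "spd B \<Longrightarrow> 0 \<le> v \<bullet> (B *v v)"
  by (cases "v = 0") (auto simp: spd_def less_imp_le)

lemma enorm_nonneg: "spd B \<Longrightarrow> 0 \<le> enorm B v"
  by (simp add: enorm_def spd_nonneg)

lemma enorm_square: "spd B \<Longrightarrow> (enorm B v)\<^sup>2 = v \<bullet> (B *v v)"
  by (simp add: enorm_def spd_nonneg)

lemma enorm_pos: "spd B \<Longrightarrow> v \<noteq> 0 \<Longrightarrow> 0 < enorm B v"
  by (simp add: enorm_def spd_def)

lemma enorm_scaleR: "enorm B (k *\<^sub>R v) = \<bar>k\<bar> * enorm B v"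
  by (simp add: enorm_def matrix_vector_mult_scaleR real_sqrt_mult flip: mult.assoc power2_eq_square)

lemma enorm_minus_commute: "enorm B (x - y) = enorm B (y - x)"
  using enorm_scaleR[of B "-1" "x - y"] by simp

lemma enorm_add_square:
  assumes "spd B"
  shows "(enorm B (x + y))\<^sup>2 = (enorm B x)\<^sup>2 + 2 * (x \<bullet> (B *v y)) + (enorm B y)\<^sup>2"
  using spd_inner_commute[OF assms, of y x]
  by (simp add: enorm_square[OF assms] matrix_vector_right_distrib inner_add_left inner_add_right)

lemma enorm_Cauchy_Schwarz:
  assumes "spd B"
  shows "x \<bullet> (B *v y) \<le> enorm B x * enorm B y"
proof (cases "x = 0 \<or> y = 0")
  case True
  then show ?thesis by (auto simp: enorm_def)
next
  case False
  define a where "a = enorm B x"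
  define b where "b = enorm B y"
  have pos: "0 < a * b"
    using False enorm_pos[OF assms] by (simp add: a_def b_def)
  have "0 \<le> (enorm B (b *\<^sub>R x + (- a) *\<^sub>R y))\<^sup>2"
    by simp
  also have "\<dots> = 2 * (a * b) * (a * b - x \<bullet> (B *v y))"
    unfolding enorm_add_square[OF assms] enorm_scaleR
    by (simp add: matrix_vector_mult_scaleR a_def[symmetric] b_def[symmetric] power_mult_distrib
        power2_eq_square algebra_simps del: scaleR_minus_left)
  finally show ?thesis
    using pos by (simp add: zero_le_mult_iff a_def b_def)
qed

lemma enorm_diff_le:
  assumes "spd B"
  shows "enorm B (x - y) \<le> enorm B x + enorm B y"
proof (rule power2_le_imp_le)
  have "(enorm B (x - y))\<^sup>2 = (enorm B x)\<^sup>2 + 2 * (x \<bullet> (B *v (- y))) + (enorm B (- y))\<^sup>2"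
    using enorm_add_square[OF assms, of x "- y"] by simp
  also have "\<dots> \<le> (enorm B x)\<^sup>2 + 2 * (enorm B x * enorm B (- y)) + (enorm B (- y))\<^sup>2"
    using enorm_Cauchy_Schwarz[OF assms, of x "- y"] by simp
  also have "enorm B (- y) = enorm B y"
    using enorm_scaleR[of B "-1" y] by simp
  also have "(enorm B x)\<^sup>2 + 2 * (enorm B x * enorm B y) + (enorm B y)\<^sup>2 = (enorm B x + enorm B y)\<^sup>2"
    by (simp add: power2_sum)
  finally show "(enorm B (x - y))\<^sup>2 \<le> (enorm B x + enorm B y)\<^sup>2" .
qed (simp add: enorm_nonneg[OF assms])

lemma enorm_le_add_orthogonal:
  assumes "spd B" and "transpose P *v (B *v w) = 0"
  shows "enorm B w \<le> enorm B (w + P *v y)"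
proof (rule power2_le_imp_le)
  have "w \<bullet> (B *v (P *v y)) = y \<bullet> (transpose P *v (B *v w))"
    using spd_inner_commute[OF assms(1)] by (simp only: inner_transpose_mult)
  then have "w \<bullet> (B *v (P *v y)) = 0"
    using assms(2) by simp
  then show "(enorm B w)\<^sup>2 \<le> (enorm B (w + P *v y))\<^sup>2"
    using enorm_add_square[OF assms(1)] by simp
qed (rule enorm_nonneg[OF assms(1)])

text \<open>
  The reduced equation says that the error is \<open>A\<close>-orthogonal to the range of \<open>Q\<close>.
\<close>

lemma galerkin_optimal:
  assumes "spd A" and "(transpose Q ** A ** Q) *v uc = transpose Q *v (A *v u)"
  shows "enorm A (u - Q *v uc) \<le> enorm A (u - Q *v v)"
proof -
  have "transpose Q *v (A *v (u - Q *v uc)) = 0"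
    using assms(2) by (simp add: matrix_vector_mult_diff_distrib matrix_vector_mul_assoc matrix_mul_assoc
        del: transpose_matrix_vector)
  from enorm_le_add_orthogonal[OF assms(1) this, of "uc - v"] show ?thesis
    by (simp add: matrix_vector_mult_diff_distrib)
qed

text \<open>
  Exchanging the lengths of \<open>x\<close> and \<open>y\<close> while keeping their directions leaves the norm of \<open>x + y\<close>
  unchanged. So a bound on the \<open>y\<close>-part of every combination of \<open>x\<close> and \<open>y\<close> is also a bound on the
  \<open>x\<close>-part; this is why complementary oblique projections have the same norm.
\<close>

lemma oblique_complement_bound:
  assumes B: "spd B" and "1 \<le> \<eta>"
    and bound: "\<And>s t. enorm B (t *\<^sub>R y) \<le> \<eta> * enorm B (s *\<^sub>R x + t *\<^sub>R y)"
  shows "enorm B x \<le> \<eta> * enorm B (x + y)"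
proof (cases "x = 0 \<or> y = 0")
  case True
  then show ?thesis
  proof
    assume "x = 0"
    then show ?thesis
      using assms(2) enorm_nonneg[OF B, of y] by (simp add: enorm_def)
  next
    assume "y = 0"
    then show ?thesis
      using mult_right_mono[OF assms(2) enorm_nonneg[OF B, of x]] by simp
  qed
next
  case False
  define a where "a = enorm B x"
  define b where "b = enorm B y"
  have pos: "0 < a" "0 < b"
    using False enorm_pos[OF B] by (simp_all add: a_def b_def)
  have "enorm B x = enorm B ((a / b) *\<^sub>R y)"
    using pos by (simp add: enorm_scaleR flip: a_def b_def)
  also have "\<dots> \<le> \<eta> * enorm B ((b / a) *\<^sub>R x + (a / b) *\<^sub>R y)"
    by (rule bound)
  also have "enorm B ((b / a) *\<^sub>R x + (a / b) *\<^sub>R y) = enorm B (x + y)"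
  proof (rule power2_eq_imp_eq)
    show "(enorm B ((b / a) *\<^sub>R x + (a / b) *\<^sub>R y))\<^sup>2 = (enorm B (x + y))\<^sup>2"
      using pos by (simp add: enorm_add_square[OF B] enorm_scaleR matrix_vector_mult_scaleR
          power_divide flip: a_def b_def)
  qed (simp_all add: enorm_nonneg[OF B])
  finally show ?thesis .
qed

text \<open>
  Cauchy-Schwarz in the \<open>D\<close>-inner product, applied to \<open>x\<close> and \<open>D\<^sup>-\<^sup>1 y\<close>.
\<close>

lemma inner_le_enorm_dual:
  assumes "spd D" "diagonal D"
  shows "x \<bullet> y \<le> enorm D x * norm (diag_inv_sqrt D *v y)"
proof -
  define H where "H = diag_inv_sqrt D"
  have H: "spd H"
    unfolding H_def using assms by (rule spd_diag_inv_sqrt)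
  have "D ** (H ** H) = mat 1"
    using diag_inv_sqrt_square[OF assms] by (simp add: H_def matrix_left_right_inverse)
  then have y: "D *v (H *v (H *v y)) = y"
    by (simp add: matrix_vector_mul_assoc)
  have "x \<bullet> y \<le> enorm D x * enorm D (H *v (H *v y))"
    using enorm_Cauchy_Schwarz[OF assms(1), of x "H *v (H *v y)"] by (simp only: y)
  also have "enorm D (H *v (H *v y)) = norm (H *v y)"
    using spd_inner_commute[OF H, of y "H *v y"]
    by (simp add: enorm_def y norm_eq_sqrt_inner inner_commute)
  finally show ?thesis
    by (simp add: H_def)
qed

section \<open>From local to global complements\<close>

lemma diagonal_mult_component:
  assumes "diagonal D"
  shows "(D *v w) $ i = D $ i $ i * w $ i"
proof -
  have "(D *v w) $ i = (\<Sum>j\<in>UNIV. if j = i then D $ i $ i * w $ i else 0)"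
    unfolding matrix_vector_mult_def vec_lambda_beta
    using assms by (intro sum.cong) (auto simp: diagonal_def)
  then show ?thesis by simp
qed

lemma local_inner_diagonal:
  assumes "diagonal D"
  shows "local_inner D S v w = (\<Sum>i\<in>S. v $ i * D $ i $ i * w $ i)"
  unfolding local_inner_def
proof (rule sum.cong)
  fix i assume i: "i \<in> S"
  have "(\<Sum>j\<in>S. v $ i * D $ i $ j * w $ j) = (\<Sum>j\<in>S. if j = i then v $ i * D $ i $ i * w $ i else 0)"
    using assms by (intro sum.cong) (auto simp: diagonal_def)
  then show "(\<Sum>j\<in>S. v $ i * D $ i $ j * w $ j) = v $ i * D $ i $ i * w $ i"
    using i by (simp add: finite_subset[OF subset_UNIV])
qed simp

lemma local_inner_eq_inner:
  assumes "diagonal D" and "v \<in> supported_on S \<or> w \<in> supported_on S"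
  shows "local_inner D S v w = v \<bullet> (D *v w)"
proof -
  have "(\<Sum>i\<in>S. v $ i * D $ i $ i * w $ i) = (\<Sum>i\<in>UNIV. v $ i * D $ i $ i * w $ i)"
    using assms(2) by (intro sum.mono_neutral_left) (auto simp: supported_on_def)
  then show ?thesis
    by (simp add: local_inner_diagonal[OF assms(1)] inner_vec_def diagonal_mult_component[OF assms(1)]
        mult.assoc)
qed

lemma disjoint_supports_orthogonal:
  assumes "diagonal D" "v \<in> supported_on S" "w \<in> supported_on S'" "S \<inter> S' = {}"
  shows "v \<bullet> (D *v w) = 0"
proof -
  have "v $ i * (D $ i $ i * w $ i) = 0" for i
    using assms(2-4) by (auto simp: supported_on_def)
  then show ?thesis
    by (simp only: inner_vec_def diagonal_mult_component[OF assms(1)] inner_real_def sum.neutral_const)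
qed

lemma column_supported: "block_diagonal \<A> c P \<Longrightarrow> column j P \<in> supported_on (c j)"
  by (simp add: block_diagonal_def supported_on_def column_def)

lemma matrix_entry_columns:
  fixes P :: "real^'m^'n" and Q :: "real^'k^'n"
  shows "(transpose P ** D ** Q) $ i $ j = column i P \<bullet> (D *v column j Q)"
proof -
  have "(transpose P ** D ** Q) $ i $ j = axis i 1 \<bullet> ((transpose P ** D ** Q) *v axis j 1)"
    by (simp add: matrix_vector_mult_basis column_def inner_axis')
  also have "\<dots> = axis i 1 \<bullet> (transpose P *v (D *v (Q *v axis j 1)))"
    by (simp only: matrix_vector_mul_assoc matrix_mul_assoc)
  finally show ?thesis
    by (simp only: inner_transpose_mult matrix_vector_mult_basis)
qed

lemma span_columns_subset_range:
  fixes Q :: "real^'k^'n"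
  shows "span (columns Q) \<subseteq> range ((*v) Q)"
  by (rule span_minimal) (auto simp: columns_image_basis intro!: linear_subspace_image)

context
  fixes D :: "real^'n^'n" and \<A> :: "'n::finite set set"
    and c :: "'c::finite \<Rightarrow> 'n set" and P :: "real^'c^'n"
    and d :: "'f::finite \<Rightarrow> 'n set" and Q :: "real^'f^'n"
  assumes diag: "diagonal D" and part: "partition_on UNIV \<A>"
    and basis: "complement_basis D \<A> c P d Q"
begin

lemma aggregates_disjoint: "S \<in> \<A> \<Longrightarrow> S' \<in> \<A> \<Longrightarrow> S \<noteq> S' \<Longrightarrow> S \<inter> S' = {}"
  using part by (auto simp: partition_on_def disjoint_def)

lemma Q_block: "block_diagonal \<A> d Q"
  using basis by (simp add: complement_basis_def)

text \<open>
  Columns of one aggregate are orthonormal by construction; columns of different aggregates have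
  disjoint supports, which a diagonal matrix cannot couple.
\<close>

lemma complement_basis_orthonormal: "transpose Q ** D ** Q = mat 1"
proof (simp only: vec_eq_iff matrix_entry_columns, intro allI)
  fix k l
  have d: "d k \<in> \<A>" "d l \<in> \<A>"
    using Q_block by (auto simp: block_diagonal_def)
  show "column k Q \<bullet> (D *v column l Q) = mat 1 $ k $ l"
  proof (cases "d k = d l")
    case True
    have "column k Q \<bullet> (D *v column l Q) = local_inner D (d k) (column k Q) (column l Q)"
      using local_inner_eq_inner[OF diag] column_supported[OF Q_block] by metis
    also have "\<dots> = (if k = l then 1 else 0)"
      using basis d True by (simp add: complement_basis_def)
    finally show ?thesis by (simp add: mat_def)
  next
    case False
    then have "column k Q \<bullet> (D *v column l Q) = 0"
      using disjoint_supports_orthogonal[OF diag] column_supported[OF Q_block] aggregates_disjoint d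
      by metis
    then show ?thesis using False by (auto simp: mat_def)
  qed
qed

lemma complement_basis_orthogonal:
  assumes P: "block_diagonal \<A> c P" and D: "spd D"
  shows "transpose P ** D ** Q = 0"
proof (simp only: vec_eq_iff matrix_entry_columns zero_index, intro allI)
  fix j k
  have d: "c j \<in> \<A>" "d k \<in> \<A>"
    using P Q_block by (auto simp: block_diagonal_def)
  show "column j P \<bullet> (D *v column k Q) = 0"
  proof (cases "c j = d k")
    case True
    have "column k Q \<in> block_range d Q (d k)"
      unfolding block_range_def by (rule span_base) auto
    then have "column k Q \<in> local_complement D c P (d k)"
      using basis d by (simp add: complement_basis_def)
    moreover have "column j P \<in> block_range c P (d k)"
      using True by (auto simp: block_range_def intro: span_base)
    ultimately have "local_inner D (d k) (column k Q) (column j P) = 0"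
      by (simp add: local_complement_def)
    then show ?thesis
      using local_inner_eq_inner[OF diag] column_supported[OF Q_block] spd_inner_commute[OF D] by metis
  next
    case False
    then show ?thesis
      using disjoint_supports_orthogonal[OF diag] column_supported[OF Q_block] column_supported[OF P]
        aggregates_disjoint d by metis
  qed
qed

text \<open>
  A vector that is \<open>D\<close>-orthogonal to the range of \<open>P\<close> is cut into its restrictions to the
  aggregates. Since each column of \<open>P\<close> lives on one aggregate, every restriction is still orthogonal
  to the columns of its own aggregate, hence in the local complement, which the columns of \<open>Q\<close> span.
\<close>

lemma complement_basis_complete:
  assumes D: "spd D" and P: "block_diagonal \<A> c P" and w: "transpose P *v (D *v w) = 0"
  shows "\<exists>y. w = Q *v y"
proof -
  define restr where "restr S = (\<chi> i. if i \<in> S then w $ i else 0)" for S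
  have piece: "restr S \<in> range ((*v) Q)" if S: "S \<in> \<A>" for S
  proof -
    have supp: "restr S \<in> supported_on S"
      by (simp add: restr_def supported_on_def)
    have col: "restr S \<bullet> (D *v column j P) = 0" if "c j = S" for j
    proof -
      have cj: "column j P \<in> supported_on S"
        using column_supported[OF P, of j] that by simp
      have "restr S \<bullet> (D *v column j P) = local_inner D S (restr S) (column j P)"
        using local_inner_eq_inner[OF diag] cj by metis
      also have "\<dots> = local_inner D S w (column j P)"
        by (simp add: local_inner_def restr_def)
      also have "\<dots> = w \<bullet> (D *v column j P)"
        using local_inner_eq_inner[OF diag] cj by metis
      also have "\<dots> = column j P \<bullet> (D *v w)"
        by (rule spd_inner_commute[OF D])
      also have "\<dots> = axis j 1 \<bullet> (transpose P *v (D *v w))"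
        by (simp only: inner_transpose_mult matrix_vector_mult_basis)
      finally show ?thesis by (simp only: w inner_zero_right)
    qed
    have lin: "linear (\<lambda>z. restr S \<bullet> (D *v z))"
      by (rule linearI) (simp_all add: matrix_vector_right_distrib matrix_vector_mult_scaleR inner_add_right)
    have "local_inner D S (restr S) z = 0" if "z \<in> block_range c P S" for z
    proof -
      have "restr S \<bullet> (D *v z) = 0"
        using linear_eq_0_on_span[OF lin _ that[unfolded block_range_def]] col by auto
      then show ?thesis
        using local_inner_eq_inner[OF diag] supp by metis
    qed
    then have "restr S \<in> local_complement D c P S"
      using supp by (simp add: local_complement_def)
    also have "\<dots> = block_range d Q S"
      using basis S by (simp add: complement_basis_def)
    also have "\<dots> \<subseteq> span (columns Q)"
      unfolding block_range_def by (rule span_mono) (auto simp: columns_def)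
    also have "\<dots> \<subseteq> range ((*v) Q)"
      by (rule span_columns_subset_range)
    finally show ?thesis .
  qed
  have "w = (\<Sum>S\<in>\<A>. restr S)"
  proof (simp only: vec_eq_iff sum_component, intro allI)
    fix i
    obtain S where S: "S \<in> \<A>" "i \<in> S"
      using partition_onD1[OF part] by blast
    have "restr S' $ i = (if S' = S then w $ i else 0)" if "S' \<in> \<A>" for S'
      using aggregates_disjoint[OF that S(1)] S(2) by (auto simp: restr_def)
    then have "(\<Sum>S'\<in>\<A>. restr S' $ i) = (\<Sum>S'\<in>\<A>. if S' = S then w $ i else 0)"
      by (intro sum.cong) auto
    then show "w $ i = (\<Sum>S'\<in>\<A>. restr S' $ i)"
      using S(1) by (simp add: finite_subset[OF subset_UNIV])
  qed
  moreover have "(\<Sum>S\<in>\<A>. restr S) \<in> range ((*v) Q)"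
    using piece by (intro subspace_sum linear_subspace_image) auto
  ultimately show ?thesis by auto
qed

end

text \<open>
  Full column rank makes \<open>P\<^sup>T D P\<close> injective, so its inverse in the formula for \<open>\<pi>\<^sub>D\<close> is a true
  inverse and \<open>u - \<pi>\<^sub>D u\<close> satisfies the normal equations.
\<close>

lemma pi_D_decomposition:
  fixes P :: "real^'c^'n"
  assumes D: "spd D" and rank: "rank P = CARD('c)"
  shows "\<exists>vc. pi_D D P *v u = P *v vc \<and> transpose P *v (D *v (u - P *v vc)) = 0"
proof -
  define G where "G = transpose P ** D ** P"
  define vc where "vc = matrix_inv G *v (transpose P *v (D *v u))"
  have G: "G *v y = transpose P *v (D *v (P *v y))" for y
    by (simp only: G_def matrix_vector_mul_assoc matrix_mul_assoc)
  have "y = 0" if "G *v y = 0" for y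
  proof -
    have "(P *v y) \<bullet> (D *v (P *v y)) = y \<bullet> (G *v y)"
      by (simp only: G inner_transpose_mult)
    then have "(P *v y) \<bullet> (D *v (P *v y)) = 0"
      using that by simp
    then have "P *v y = 0"
      using D by (auto simp: spd_def)
    then show ?thesis
      using rank full_rank_injective[of P] by (metis injD matrix_vector_mult_0_right)
  qed
  then have "G *v vc = transpose P *v (D *v u)"
    unfolding vc_def by (rule mult_matrix_inv)
  then have "transpose P *v (D *v (u - P *v vc)) = 0"
    unfolding G by (simp add: matrix_vector_mult_diff_distrib del: transpose_matrix_vector) 
  moreover have "pi_D D P *v u = P *v vc"
    by (simp only: pi_D_def vc_def G_def matrix_vector_mul_assoc matrix_mul_assoc)
  ultimately show ?thesis by blast
qed


section \<open>Error of the two-level method\<close>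

text \<open>
  CG minimises the energy error over the Krylov space, so it does at least as well as the Chebyshev
  residual.
\<close>

lemma cg_error_bound:
  assumes M: "transpose M = M" "\<And>x. x \<bullet> (M *v x) \<le> x \<bullet> x"
      "\<And>x. x \<bullet> x \<le> \<eta>\<^sup>2 * (x \<bullet> (M *v x))"
    and "1 \<le> \<eta>"
    and cg: "cg_iterate M b k g"
  shows "enorm M (matrix_inv M *v b - g) \<le> 2 * ((\<eta> - 1) / (\<eta> + 1)) ^ k * enorm M (matrix_inv M *v b)"
proof -
  interpret spectral_interval "(*v) M" \<eta>
  proof (rule spectral_interval.intro)
    show "linear ((*v) M)" by simp
    show "(M *v x) \<bullet> y = x \<bullet> (M *v y)" for x y
      using inner_transpose_mult[of x M y] M(1) by simp
  qed (use M assms(4) in auto)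
  define e where "e = matrix_inv M *v b"
  have e: "M *v e = b"
    unfolding e_def
  proof (rule mult_matrix_inv)
    show "x = 0" if "M *v x = 0" for x
      using M(3)[of x] that inner_ge_zero[of x] inner_eq_zero_iff[of x]
      by (simp only: inner_zero_right mult_zero_right) linarith
  qed
  have krylov: "K (M *v e) k = krylov M b k"
  proof -
    have "(((*v) M) ^^ i) b = matpow M i *v b" for i
      by (induction i) (simp_all add: matrix_vector_mul_assoc)
    then show ?thesis
      by (simp add: K_def krylov_def e)
  qed
  obtain y where y: "y \<in> krylov M b k"
    and le: "(e - y) \<bullet> (M *v (e - y)) \<le> (2 * \<rho> ^ k)\<^sup>2 * (e \<bullet> (M *v e))"
    using krylov_energy_bound[of e k] by (auto simp: krylov)
  have "enorm M (e - g) \<le> enorm M (e - y)"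
    using cg y unfolding cg_iterate_def e_def[symmetric] by (metis enorm_minus_commute)
  also have "\<dots> \<le> sqrt ((2 * \<rho> ^ k)\<^sup>2 * (e \<bullet> (M *v e)))"
    unfolding enorm_def using le by (rule real_sqrt_le_mono)
  also have "\<dots> = 2 * \<rho> ^ k * enorm M e"
    using assms(4) by (simp add: enorm_def real_sqrt_mult \<rho>_def)
  finally show ?thesis
    by (simp add: e_def \<rho>_def)
qed

theorem theorem4p9:
  fixes A D :: "real^'n^'n"
    and P :: "real^'c^'n"
    and Pperp :: "real^'f^'n"
    and \<A> :: "'n set set"
    and c :: "'c \<Rightarrow> 'n set"
    and d :: "'f \<Rightarrow> 'n set"
    and \<eta> :: real
    and f u :: "real^'n"
    and uc :: "real^'c"
    and \<nu> :: nat
    and qpoly :: "real poly"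
  assumes "spd A"
    and "spd D" and "diagonal D"
    and "\<forall>v. v \<bullet> (A *v v) \<le> v \<bullet> (D *v v)"
    and "partition_on UNIV \<A>"
    and "CARD('c) < CARD('n)"
    and "CARD('f) = CARD('n) - CARD('c)"
    and "rank P = CARD('c)"
    and "block_diagonal \<A> c P"
    and "complement_basis D \<A> c P d Pperp"
    and "\<eta> > 0"
    and weak_approximation: "\<forall>v. \<exists>vc. enorm D (v - P *v vc) \<le> \<eta> * enorm A v"
    and "A *v u = f"
    and "\<nu> \<ge> 1"
    and "degree qpoly \<le> \<nu> - 1"
    and "cg_iterate (A_f A Pperp) (transpose Pperp *v (A *v (pi_D D P *v u))) \<nu>
           (mat_poly qpoly (A_f A Pperp) *v (transpose Pperp *v (A *v (pi_D D P *v u))))"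
    and "(transpose (P_approx A Pperp qpoly P) ** A ** P_approx A Pperp qpoly P) *v uc
           = transpose (P_approx A Pperp qpoly P) *v f"
  shows "enorm A (u - P_approx A Pperp qpoly P *v uc)
           \<le> \<eta> * norm (diag_inv_sqrt D *v (A *v u))
             + 2 * ((\<eta> - 1) / (\<eta> + 1)) ^ \<nu> * \<eta> * enorm A u"
proof -
  note A = assms(1) and D = assms(2) and diag = assms(3) and part = assms(5)
  note mult_assocs = matrix_vector_mul_assoc matrix_mul_assoc
  define M where "M = A_f A Pperp"
  define b where "b = transpose Pperp *v (A *v (pi_D D P *v u))"
  define g where "g = mat_poly qpoly M *v b"
  define e where "e = matrix_inv M *v b"
  have M: "M *v y = transpose Pperp *v (A *v (Pperp *v y))" for y
    by (simp only: M_def A_f_def mult_assocs)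
  have M_inner: "x \<bullet> (M *v y) = (Pperp *v x) \<bullet> (A *v (Pperp *v y))" for x y
    by (simp only: M inner_transpose_mult)
  have enorm_M: "enorm M y = enorm A (Pperp *v y)" for y
    by (simp only: enorm_def M_inner)
  have D_Pperp: "(Pperp *v y) \<bullet> (D *v (Pperp *v y)) = y \<bullet> y" for y
  proof -
    have "(Pperp *v y) \<bullet> (D *v (Pperp *v y)) = y \<bullet> ((transpose Pperp ** D ** Pperp) *v y)"
      by (simp only: inner_transpose_mult flip: mult_assocs)
    then show ?thesis
      by (simp add: complement_basis_orthonormal[OF diag part assms(10)])
  qed
  have ortho: "transpose P *v (D *v (Pperp *v y)) = 0" for y
    by (simp only: mult_assocs complement_basis_orthogonal[OF diag part assms(10,9) D]
        matrix_vector_mult_0)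
  have weak: "enorm D w \<le> \<eta> * enorm A (w + P *v y)" if "transpose P *v (D *v w) = 0" for w y
  proof -
    obtain vc where vc: "enorm D (w + P *v y - P *v vc) \<le> \<eta> * enorm A (w + P *v y)"
      using weak_approximation by blast
    have "enorm D w \<le> enorm D (w + P *v (y - vc))"
      using D that by (rule enorm_le_add_orthogonal)
    then show ?thesis
      using vc by (simp add: matrix_vector_mult_diff_distrib add_diff_eq)
  qed
  have A_le_D: "enorm A w \<le> enorm D w" for w
    using assms(4) by (simp add: enorm_def)
  have norm_le: "enorm D (Pperp *v y) \<le> \<eta> * enorm M y" for y
    using weak[OF ortho, of y 0] by (simp add: enorm_M)
  have lower: "y \<bullet> y \<le> \<eta>\<^sup>2 * (y \<bullet> (M *v y))" for y
  proof -
    have "(enorm D (Pperp *v y))\<^sup>2 \<le> (\<eta> * enorm M y)\<^sup>2"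
      using norm_le enorm_nonneg[OF D] by (intro power_mono)
    then show ?thesis
      by (simp add: enorm_square[OF D] enorm_square[OF A] D_Pperp enorm_M M_inner power_mult_distrib)
  qed
  have upper: "y \<bullet> (M *v y) \<le> y \<bullet> y" for y
    using assms(4) by (metis M_inner D_Pperp)
  \<comment> \<open>The two bounds on the form of \<open>M\<close> are compatible only if \<open>\<eta> \<ge> 1\<close>; any nonzero vector shows this.\<close>
  have \<eta>: "1 \<le> \<eta>"
  proof -
    define y :: "real^'f" where "y = axis undefined 1"
    have "y \<bullet> y = 1" by (simp add: y_def inner_axis_axis)
    then have "1 \<le> \<eta>\<^sup>2 * (y \<bullet> (M *v y))" "\<eta>\<^sup>2 * (y \<bullet> (M *v y)) \<le> \<eta>\<^sup>2 * 1"
      using lower[of y] mult_left_mono[OF upper[of y], of "\<eta>\<^sup>2"] by simp_all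
    then have "1\<^sup>2 \<le> \<eta>\<^sup>2" by simp
    then show ?thesis
      using \<open>\<eta> > 0\<close> by (simp only: power2_le_iff_abs_le)
  qed
  have M_sym: "transpose M = M"
    using A by (simp add: M_def A_f_def spd_def matrix_transpose_mul mult_assocs)
  have M_inv: "M *v (matrix_inv M *v z) = z" for z
  proof (rule mult_matrix_inv)
    show "x = 0" if "M *v x = 0" for x
      using lower[of x] that inner_ge_zero[of x] inner_eq_zero_iff[of x]
      by (simp only: inner_zero_right mult_zero_right) linarith
  qed

  obtain vc where vc: "pi_D D P *v u = P *v vc"
    and w: "transpose P *v (D *v (u - P *v vc)) = 0"
    using pi_D_decomposition[OF D assms(8)] by blast
  obtain y where y: "u - P *v vc = Pperp *v y"
    using complement_basis_complete[OF diag part assms(10) D assms(9) w] by blast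
  have pi_D_bound: "enorm A (P *v vc) \<le> \<eta> * enorm A u"
  proof -
    have "enorm A (P *v vc) \<le> \<eta> * enorm A (P *v vc + Pperp *v y)"
    proof (rule oblique_complement_bound[OF A \<eta>])
      fix s t
      have "enorm A (t *\<^sub>R (Pperp *v y)) \<le> enorm D (Pperp *v (t *\<^sub>R y))"
        using A_le_D by (simp add: matrix_vector_mult_scaleR)
      also have "\<dots> \<le> \<eta> * enorm A (Pperp *v (t *\<^sub>R y) + P *v (s *\<^sub>R vc))"
        using ortho by (rule weak)
      finally show "enorm A (t *\<^sub>R (Pperp *v y))
          \<le> \<eta> * enorm A (s *\<^sub>R (P *v vc) + t *\<^sub>R (Pperp *v y))"
        by (simp add: matrix_vector_mult_scaleR add.commute)
    qed
    then show ?thesis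
      by (simp flip: y)
  qed

  \<comment> \<open>The vector \<open>z\<close> represents \<open>\<pi>\<^sub>f u\<close>: it solves the full fine-level system, as \<open>e\<close> represents
     \<open>\<pi>\<^sub>f \<pi>\<^sub>D u\<close> and \<open>y\<close> represents \<open>u - \<pi>\<^sub>D u\<close>.\<close>
  define z where "z = e + y"
  have Mz: "M *v z = transpose Pperp *v (A *v u)"
  proof -
    have "M *v z = b + M *v y"
      by (simp add: z_def e_def matrix_vector_right_distrib M_inv)
    also have "\<dots> = transpose Pperp *v (A *v (P *v vc + Pperp *v y))"
      by (simp only: b_def vc M matrix_vector_right_distrib)
    finally show ?thesis
      by (simp flip: y)
  qed
  have fine_bound: "enorm M z \<le> \<eta> * norm (diag_inv_sqrt D *v (A *v u))"
  proof -
    have "enorm M z * enorm M z = z \<bullet> (M *v z)"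
      by (simp add: enorm_M M_inner enorm_square[OF A] flip: power2_eq_square)
    also have "\<dots> = (Pperp *v z) \<bullet> (A *v u)"
      by (simp only: Mz inner_transpose_mult)
    also have "\<dots> \<le> enorm D (Pperp *v z) * norm (diag_inv_sqrt D *v (A *v u))"
      by (rule inner_le_enorm_dual[OF D diag])
    also have "\<dots> \<le> (\<eta> * enorm M z) * norm (diag_inv_sqrt D *v (A *v u))"
      using norm_le by (rule mult_right_mono) simp
    finally have "enorm M z * enorm M z \<le> enorm M z * (\<eta> * norm (diag_inv_sqrt D *v (A *v u)))"
      by (simp add: mult_ac)
    moreover have "0 \<le> enorm M z" "0 \<le> \<eta> * norm (diag_inv_sqrt D *v (A *v u))"
      using \<eta> enorm_nonneg[OF A] by (simp_all add: enorm_M)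
    ultimately show ?thesis
      by (cases "enorm M z = 0") auto
  qed
  have e_bound: "enorm M e \<le> \<eta> * enorm A u"
  proof -
    have "enorm M e * enorm M e = e \<bullet> (M *v e)"
      by (simp add: enorm_M M_inner enorm_square[OF A] flip: power2_eq_square)
    also have "\<dots> = (Pperp *v e) \<bullet> (A *v (P *v vc))"
      by (simp only: e_def M_inv) (simp only: b_def vc inner_transpose_mult)
    also have "\<dots> \<le> enorm M e * enorm A (P *v vc)"
      unfolding enorm_M by (rule enorm_Cauchy_Schwarz[OF A])
    finally have "enorm M e \<le> enorm A (P *v vc)"
      using enorm_nonneg[OF A, of "Pperp *v e"] enorm_nonneg[OF A, of "P *v vc"]
      by (cases "enorm M e = 0") (auto simp: enorm_M)
    then show ?thesis
      using pi_D_bound by simp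
  qed
  have cg_bound: "enorm M (e - g) \<le> 2 * ((\<eta> - 1) / (\<eta> + 1)) ^ \<nu> * enorm M e"
    using cg_error_bound[OF M_sym upper lower \<eta>] assms(16)
    unfolding e_def g_def M_def b_def by blast
  have candidate: "u - P_approx A Pperp qpoly P *v vc = Pperp *v z - Pperp *v (e - g)"
  proof -
    have "P_approx A Pperp qpoly P *v vc = P *v vc - Pperp *v g"
      by (simp only: P_approx_def pi_f_approx_def g_def b_def vc M_def[symmetric] matrix_vector_mult_diff_rdistrib
          matrix_vector_mul_lid flip: mult_assocs)
    then show ?thesis
      using y by (simp add: z_def matrix_vector_right_distrib matrix_vector_mult_diff_distrib algebra_simps)
  qed
  have "enorm A (u - P_approx A Pperp qpoly P *v uc) \<le> enorm A (u - P_approx A Pperp qpoly P *v vc)"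
    using assms(17) unfolding assms(13)[symmetric] by (rule galerkin_optimal[OF A])
  also have "\<dots> \<le> enorm M z + enorm M (e - g)"
    unfolding candidate enorm_M by (rule enorm_diff_le[OF A])
  also have "\<dots> \<le> \<eta> * norm (diag_inv_sqrt D *v (A *v u))
      + 2 * ((\<eta> - 1) / (\<eta> + 1)) ^ \<nu> * (\<eta> * enorm A u)"
  proof (rule add_mono[OF fine_bound order_trans[OF cg_bound]])
    show "2 * ((\<eta> - 1) / (\<eta> + 1)) ^ \<nu> * enorm M e
        \<le> 2 * ((\<eta> - 1) / (\<eta> + 1)) ^ \<nu> * (\<eta> * enorm A u)"
      using e_bound \<eta> by (intro mult_left_mono) simp_all
  qed
  finally show ?thesis
    by (simp add: mult.assoc)
qed

end
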